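(* Suppose that $s,t$ are integers with $2 \leq s \leq t$ and $G$ is a $K_{s,t}$-free graph with vertex set $\mathbb{N}=\{1,2,3,\dots\}$. Then $$\liminf_{n \rightarrow \infty} \frac{\delta(G_n)}{n^{1-1/s}/(\log n)^{1/s}} < \infty,$$ where $G_n$ denotes the induced subgraph of $G$ on $\{1, 2, \dots, n\}$.
   Context: $\log$ is the natural logarithm and $\delta(\cdot)$ denotes the minimum degree of a graph. A graph is $K_{s,t}$-free if it contains no (not necessarily induced) subgraph isomorphic to the complete bipartite graph $K_{s,t}$ with parts of sizes $s$ and $t$. *)

theory Defs
  imports Complex_Main "HOL-Library.Extended_Real"
begin

text \<open>Simple undirected graphs with a possibly infinite vertex set; an edge is a two-element set
  of vertices.\<close>

record 'a graph =
  verts :: "'a set"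
  edges :: "'a set set"

definition simple_graph :: "'a graph \<Rightarrow> bool" where
  "simple_graph G \<longleftrightarrow> (\<forall>e\<in>edges G. e \<subseteq> verts G \<and> card e = 2)"

definition subgraph :: "'a graph \<Rightarrow> 'a graph \<Rightarrow> bool" where
  "subgraph H G \<longleftrightarrow> simple_graph H \<and> verts H \<subseteq> verts G \<and> edges H \<subseteq> edges G"

definition graph_isomorphic :: "'a graph \<Rightarrow> 'b graph \<Rightarrow> bool" where
  "graph_isomorphic G H \<longleftrightarrow>
    (\<exists>f. bij_betw f (verts G) (verts H) \<and>
      (\<forall>u\<in>verts G. \<forall>v\<in>verts G. {u, v} \<in> edges G \<longleftrightarrow> {f u, f v} \<in> edges H))"

definition complete_bipartite :: "nat \<Rightarrow> nat \<Rightarrow> (nat + nat) graph" where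
  "complete_bipartite s t =
    \<lparr>verts = {..<s} <+> {..<t}, edges = {{Inl i, Inr j} | i j. i < s \<and> j < t}\<rparr>"

definition complete_bipartite_free :: "nat \<Rightarrow> nat \<Rightarrow> 'a graph \<Rightarrow> bool" where
  "complete_bipartite_free s t G \<longleftrightarrow>
    \<not> (\<exists>H. subgraph H G \<and> graph_isomorphic H (complete_bipartite s t))"

definition induced_subgraph :: "'a graph \<Rightarrow> 'a set \<Rightarrow> 'a graph" where
  "induced_subgraph G W = \<lparr>verts = verts G \<inter> W, edges = {e \<in> edges G. e \<subseteq> W}\<rparr>"

definition degree :: "'a graph \<Rightarrow> 'a \<Rightarrow> nat" where
  "degree G v = card {u \<in> verts G. {v, u} \<in> edges G}"

text \<open>Meaningful for finite graphs with at least one vertex.\<close>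

definition min_degree :: "'a graph \<Rightarrow> nat" where
  "min_degree G = Min (degree G ` verts G)"

end

theory Submission
  imports Defs "HOL-Analysis.Convex"
begin

text \<open>
  The argument transfers to graphs the proof of Erdos that the counting function \<open>A\<close> of an infinite
  Sidon set satisfies \<open>liminf A(n) sqrt(log n / n) < \<infinity>\<close>.

  Fix a large \<open>N = 2^L\<close> and let \<open>d(u)\<close> be the number of neighbours of \<open>u\<close> in \<open>{1..N}\<close>.
  As \<open>s\<close> vertices have fewer than \<open>t\<close> common neighbours, counting stars with \<open>s\<close> leaves in
  \<open>{1..N}\<close> and centre in \<open>{1..N\<^sup>2}\<close> gives \<open>\<Sum>u\<le>N\<^sup>2. d(u)^s \<le> C N^s\<close>
  (\<open>sum_power_degrees_le\<close>). The range may be as long as \<open>N\<^sup>2\<close> because each of its vertices costs only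
  \<open>O(1)\<close> in the passage between \<open>d(u)^s\<close> and binomial coefficients, and \<open>N\<^sup>2 \<le> N^s\<close>.

  Let \<open>n\<^sub>i = 2^i N\<close> for \<open>1 \<le> i \<le> L\<close> and \<open>D\<^sub>i = \<Sum>u\<le>n\<^sub>i. d(u)\<close>. The power mean inequality alone only
  bounds each \<open>D\<^sub>i^s / n\<^sub>i^(s-1)\<close> by a multiple of the whole budget \<open>N^s\<close>. The key point is that
  their sum over the \<open>L\<close> scales obeys the same bound, up to a constant (\<open>sum_dyadic_le\<close>): the
  normalisation \<open>n\<^sub>i^(s-1)\<close> at least doubles from one scale to the next, so that what the earlier
  scales contribute to \<open>D\<^sub>i\<close> decays geometrically, and the new contributions come from disjoint ranges
  of \<open>u\<close>.

  On the other hand, counting the same edges from \<open>{1..N}\<close> gives \<open>D\<^sub>i \<ge> N \<delta>(G\<^sub>n)\<close> with \<open>n = n\<^sub>i\<close>. If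
  \<open>\<delta>(G\<^sub>n) > K n^(1-1/s) / (log n)^(1/s)\<close> for all large \<open>n\<close>, then each of the \<open>L\<close> terms exceeds
  \<open>K^s N^s / log (N\<^sup>2)\<close>, where \<open>log (N\<^sup>2) \<le> 2 L\<close>, and the sum exceeds \<open>K^s N^s / 2\<close>. This is
  impossible for large \<open>K\<close>.
\<close>

section \<open>Convexity of powers\<close>

lemma convex_on_power_nonneg: "convex_on {0::real..} (\<lambda>x. x ^ n)"
proof (cases "even n")
  case True
  show ?thesis
    by (rule convex_on_subset[OF convex_power_even[OF True]]) auto
next
  case False
  then show ?thesis by (rule convex_power_odd)
qed

lemma power_sum_le_card_power_mult_sum_power:
  fixes x :: "'a \<Rightarrow> real"
  assumes "finite A" "\<And>a. a \<in> A \<Longrightarrow> 0 \<le> x a" "0 < k"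
  shows "(\<Sum>a\<in>A. x a) ^ k \<le> real (card A) ^ (k - 1) * (\<Sum>a\<in>A. x a ^ k)"
proof (cases "A = {}")
  case True
  then show ?thesis using assms(3) by (simp add: zero_power)
next
  case False
  define c where "c = real (card A)"
  have c: "c > 0" using False assms by (simp add: c_def card_gt_0_iff)
  have "(\<Sum>a\<in>A. (1 / c) *\<^sub>R x a) ^ k \<le> (\<Sum>a\<in>A. (1 / c) * x a ^ k)"
    by (rule convex_on_sum[OF assms(1) False convex_on_power_nonneg])
      (use assms c in \<open>auto simp: c_def\<close>)
  then have "((\<Sum>a\<in>A. x a) / c) ^ k \<le> (\<Sum>a\<in>A. x a ^ k) / c"
    by (simp add: sum_divide_distrib)
  then have "(\<Sum>a\<in>A. x a) ^ k \<le> (\<Sum>a\<in>A. x a ^ k) / c * c ^ k"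
    using c by (simp add: power_divide field_simps)
  also have "\<dots> = c ^ (k - 1) * (\<Sum>a\<in>A. x a ^ k)"
    using c assms(3) by (cases k) auto
  finally show ?thesis by (simp add: c_def)
qed

text \<open>
  The factor in front of \<open>x^k\<close> has to be below \<open>2^(k-1)\<close>; the plain \<open>(x + y)^k \<le> 2^(k-1) (x^k + y^k)\<close>
  would lose the geometric decay in \<open>sum_dyadic_le\<close>.
\<close>

lemma power_add_le_weighted:
  fixes x y :: real
  assumes "0 \<le> x" "0 \<le> y" "0 < k"
  shows "(x + y) ^ k \<le> (3 / 2) ^ (k - 1) * x ^ k + 3 ^ (k - 1) * y ^ k"
proof -
  have "((1 - 1 / 3) *\<^sub>R (3 / 2 * x) + (1 / 3) *\<^sub>R (3 * y)) ^ k
      \<le> (1 - 1 / 3) * (3 / 2 * x) ^ k + (1 / 3) * (3 * y) ^ k"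
    by (rule convex_onD[OF convex_on_power_nonneg]) (use assms in auto)
  then have "(x + y) ^ k \<le> 2 / 3 * (3 / 2 * x) ^ k + 1 / 3 * (3 * y) ^ k" by simp
  also have "\<dots> = (3 / 2) ^ (k - 1) * x ^ k + 3 ^ (k - 1) * y ^ k"
    unfolding power_mult_distrib using assms(3) by (cases k) auto
  finally show ?thesis .
qed

section \<open>Partial sums at dyadic scales\<close>

text \<open>
  Write \<open>Y i\<close> for the \<open>i\<close>-th term on the left. Splitting off the range \<open>{2^i N<..2^(i+1) N}\<close> gives
  \<open>Y (i + 1) \<le> 3/4 Y i + 3^(k-1) Z\<close>, where \<open>Z\<close> is the sum of \<open>d u ^ k\<close> over that range. The induction
  carries an extra term \<open>3 Y L\<close>, because then the step needs exactly
  \<open>4 Y (L + 1) \<le> 3 Y L + 4 3^(k-1) Z\<close>.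
\<close>

lemma sum_dyadic_le:
  fixes d :: "nat \<Rightarrow> real"
  assumes d: "\<And>u. 0 \<le> d u" and k: "2 \<le> k" and N: "0 < N"
  shows "(\<Sum>i=1..L. (\<Sum>u=1..2^i * N. d u) ^ k / real (2^i * N) ^ (k - 1))
    \<le> 4 * 3 ^ (k - 1) * (\<Sum>u=1..2^L * N. d u ^ k)"
proof -
  define n where "n i = 2^i * N" for i
  define D where "D i = (\<Sum>u=1..n i. d u)" for i
  define Y where "Y i = D i ^ k / real (n i) ^ (k - 1)" for i
  define P where "P i = (\<Sum>u=1..n i. d u ^ k)" for i
  have npos: "0 < n i" for i using N by (simp add: n_def)
  have D0: "0 \<le> D i" for i unfolding D_def by (intro sum_nonneg d)
  have Y0: "0 \<le> Y i" for i unfolding Y_def using D0 by simp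
  have step: "Y (Suc i) \<le> 3 / 4 * Y i + 3 ^ (k - 1) * (P (Suc i) - P i)" for i
  proof -
    define E where "E = (\<Sum>u=n i+1..n (Suc i). d u)"
    define Z where "Z = (\<Sum>u=n i+1..n (Suc i). d u ^ k)"
    have n2: "n (Suc i) = n i + n i" by (simp add: n_def)
    have DE: "D (Suc i) = D i + E" and PZ: "P (Suc i) - P i = Z"
      unfolding D_def E_def P_def Z_def n2 by (subst sum.ub_add_nat; simp)+
    have E0: "0 \<le> E" unfolding E_def by (intro sum_nonneg d)
    have Z0: "0 \<le> Z" unfolding Z_def by (intro sum_nonneg zero_le_power d)
    define m where "m = real (n i) ^ (k - 1)"
    have m: "m > 0" using npos by (simp add: m_def)
    have nm: "real (n (Suc i)) ^ (k - 1) = 2 ^ (k - 1) * m"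
      by (simp add: n_def m_def power_mult_distrib)
    have EZ: "E ^ k \<le> m * Z"
      using power_sum_le_card_power_mult_sum_power[of "{n i+1..n (Suc i)}" d k] d k
      by (simp add: E_def Z_def m_def n2)
    have "Y (Suc i) = (D i + E) ^ k / (2 ^ (k - 1) * m)" by (simp only: Y_def DE nm)
    also have "\<dots> \<le> ((3 / 2) ^ (k - 1) * D i ^ k + 3 ^ (k - 1) * E ^ k) / (2 ^ (k - 1) * m)"
      using power_add_le_weighted[of "D i" E k] D0 E0 k m by (intro divide_right_mono) auto
    also have "\<dots> = (3 / 4) ^ (k - 1) * (D i ^ k / m) + 3 ^ (k - 1) * (E ^ k / m / 2 ^ (k - 1))"
    proof -
      have "(3 / 2 :: real) ^ (k - 1) = 2 ^ (k - 1) * (3 / 4) ^ (k - 1)"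
        by (simp flip: power_mult_distrib)
      moreover have "(c * r * x + a * y) / (c * m) = r * (x / m) + a * (y / m / c)"
        if "c > 0" for a c r x y :: real
        using that m by (simp add: field_simps)
      ultimately show ?thesis by simp
    qed
    also have "\<dots> \<le> 3 / 4 * Y i + 3 ^ (k - 1) * Z"
    proof (intro add_mono mult_left_mono)
      show "(3 / 4) ^ (k - 1) * (D i ^ k / m) \<le> 3 / 4 * Y i"
        using power_decreasing[of 1 "k - 1" "3 / 4 :: real"] k Y0[of i]
        unfolding Y_def m_def[symmetric] by (intro mult_right_mono) auto
      have "E ^ k / m \<le> Z" using EZ m by (simp add: field_simps)
      then have "E ^ k / m / 2 ^ (k - 1) \<le> Z / 2 ^ (k - 1)" by (rule divide_right_mono) simp
      also have "\<dots> \<le> Z / 1" using Z0 by (intro divide_left_mono) auto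
      finally show "E ^ k / m / 2 ^ (k - 1) \<le> Z" by simp
    qed simp
    finally show ?thesis by (simp add: PZ)
  qed
  have "(\<Sum>i=1..L. Y i) + 3 * Y L \<le> 4 * 3 ^ (k - 1) * P L"
  proof (induction L)
    case 0
    have "D 0 ^ k \<le> real (n 0) ^ (k - 1) * P 0"
      using power_sum_le_card_power_mult_sum_power[of "{1..n 0}" d k] d k
      by (simp add: D_def P_def)
    then have "Y 0 \<le> P 0" unfolding Y_def using npos[of 0] by (simp add: field_simps)
    moreover have "3 * P 0 \<le> 4 * 3 ^ (k - 1) * P 0"
    proof (rule mult_right_mono)
      show "3 \<le> 4 * (3::real) ^ (k - 1)" using one_le_power[of "3::real" "k - 1"] by linarith
      show "0 \<le> P 0" unfolding P_def by (intro sum_nonneg zero_le_power d)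
    qed
    ultimately show ?case by simp
  next
    case (Suc L)
    then show ?case using step[of L] by (simp add: algebra_simps)
  qed
  then show ?thesis using Y0[of L] by (simp add: Y_def D_def P_def n_def)
qed

section \<open>Counting stars\<close>

lemma card_common_neighbours_less:
  assumes "simple_graph G" and free: "complete_bipartite_free s t G"
    and S: "finite S" "card S = s" "S \<subseteq> verts G"
    and T: "finite T" "T \<subseteq> verts G"
    and adj: "\<And>v u. v \<in> S \<Longrightarrow> u \<in> T \<Longrightarrow> {v, u} \<in> edges G"
  shows "card T < t"
proof (rule ccontr)
  assume "\<not> card T < t"
  then obtain T' where T': "T' \<subseteq> T" "card T' = t" "finite T'"
    by (meson not_less obtain_subset_with_card_n)
  have disj: "S \<inter> T' = {}"
  proof (rule ccontr)
    assume "S \<inter> T' \<noteq> {}"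
    then obtain x where "{x, x} \<in> edges G" using adj T' by blast
    then have "card {x, x} = 2" using assms(1) unfolding simple_graph_def by blast
    then show False by simp
  qed
  obtain a where a: "bij_betw a S {..<s}"
    using S by (metis card_lessThan finite_lessThan finite_same_card_bij)
  obtain b where b: "bij_betw b T' {..<t}"
    using T' by (metis card_lessThan finite_lessThan finite_same_card_bij)
  define H where "H = \<lparr>verts = S \<union> T', edges = {{v, u} | v u. v \<in> S \<and> u \<in> T'}\<rparr>"
  define f :: "'a \<Rightarrow> nat + nat" where "f x = (if x \<in> S then Inl (a x) else Inr (b x))" for x
  have "subgraph H G"
    unfolding subgraph_def simple_graph_def H_def
    using S T T' adj disj by (auto simp: card_insert_if)
  moreover have "graph_isomorphic H (complete_bipartite s t)"
    unfolding graph_isomorphic_def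
  proof (intro exI conjI ballI)
    have "inj_on f (S \<union> T')"
      using a b unfolding f_def bij_betw_def inj_on_def by auto
    moreover have "f ` (S \<union> T') = {..<s} <+> {..<t}"
    proof -
      have "f ` S = Inl ` a ` S" "f ` T' = Inr ` b ` T'"
        using disj by (auto simp: f_def image_iff)
      then show ?thesis using a b by (simp add: image_Un bij_betw_def Plus_def)
    qed
    ultimately show "bij_betw f (verts H) (verts (complete_bipartite s t))"
      by (simp add: bij_betw_def H_def complete_bipartite_def)
  next
    fix u v assume uv: "u \<in> verts H" "v \<in> verts H"
    have bounds: "a x < s" if "x \<in> S" for x using a that by (auto simp: bij_betw_def)
    have bounds': "b x < t" if "x \<in> T'" for x using b that by (auto simp: bij_betw_def)
    show "{u, v} \<in> edges H \<longleftrightarrow> {f u, f v} \<in> edges (complete_bipartite s t)"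
      using uv disj bounds bounds'
      by (auto simp: H_def complete_bipartite_def f_def doubleton_eq_iff)
  qed
  ultimately show False using free unfolding complete_bipartite_free_def by blast
qed

text \<open>
  The left-hand side counts the pairs of a vertex of \<open>U\<close> and an \<open>s\<close>-set of its neighbours in \<open>W\<close>;
  each \<open>s\<close>-set occurs in fewer than \<open>t\<close> of these pairs.
\<close>

lemma sum_degree_choose_le:
  assumes "simple_graph G" "complete_bipartite_free s t G"
    and U: "finite U" "U \<subseteq> verts G" and W: "finite W" "W \<subseteq> verts G"
  shows "(\<Sum>u\<in>U. card {v \<in> W. {v, u} \<in> edges G} choose s) \<le> t * (card W choose s)"
proof -
  define \<S> where "\<S> = {S. S \<subseteq> W \<and> card S = s}"
  have fin: "finite \<S>" unfolding \<S>_def using W by simp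
  have "(\<Sum>u\<in>U. card {v \<in> W. {v, u} \<in> edges G} choose s)
      = (\<Sum>u\<in>U. card {S \<in> \<S>. \<forall>v\<in>S. {v, u} \<in> edges G})"
  proof (rule sum.cong[OF refl])
    fix u
    have "card {v \<in> W. {v, u} \<in> edges G} choose s
        = card {S. S \<subseteq> {v \<in> W. {v, u} \<in> edges G} \<and> card S = s}"
      using W by (simp add: n_subsets)
    also have "{S. S \<subseteq> {v \<in> W. {v, u} \<in> edges G} \<and> card S = s}
        = {S \<in> \<S>. \<forall>v\<in>S. {v, u} \<in> edges G}"
      by (auto simp: \<S>_def)
    finally show "card {v \<in> W. {v, u} \<in> edges G} choose s
        = card {S \<in> \<S>. \<forall>v\<in>S. {v, u} \<in> edges G}" .
  qed
  also have "\<dots> = (\<Sum>S\<in>\<S>. card {u \<in> U. \<forall>v\<in>S. {v, u} \<in> edges G})"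
    using sum_multicount_gen[OF U(1) fin] by (smt (verit) Collect_cong sum.cong)
  also have "\<dots> \<le> (\<Sum>S\<in>\<S>. t)"
  proof (rule sum_mono)
    fix S assume "S \<in> \<S>"
    then have "finite S" "card S = s" "S \<subseteq> verts G"
      using W finite_subset by (auto simp: \<S>_def)
    then have "card {u \<in> U. \<forall>v\<in>S. {v, u} \<in> edges G} < t"
      by (rule card_common_neighbours_less[OF assms(1,2)]) (use U in auto)
    then show "card {u \<in> U. \<forall>v\<in>S. {v, u} \<in> edges G} \<le> t" by simp
  qed
  also have "\<dots> = t * (card W choose s)" using W by (simp add: \<S>_def n_subsets)
  finally show ?thesis .
qed

lemma power_le_self_power_mult_choose:
  assumes "0 < k"
  shows "real n ^ k \<le> real k ^ k * (real (n choose k) + 1)"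
proof (cases "k \<le> n")
  case True
  have "real n ^ k = real k ^ k * (real n / real k) ^ k"
    using assms by (simp add: power_divide)
  also have "\<dots> \<le> real k ^ k * (real (n choose k) + 1)"
    using binomial_ge_n_over_k_pow_k[OF True, where 'a=real] by (intro mult_left_mono) auto
  finally show ?thesis .
next
  case False
  then have "real n ^ k \<le> real k ^ k * 1" by (simp add: power_mono)
  also have "\<dots> \<le> real k ^ k * (real (n choose k) + 1)" by (intro mult_left_mono) auto
  finally show ?thesis .
qed

text \<open>
  Vertices with fewer than \<open>s\<close> neighbours in \<open>W\<close> are centres of no stars, so they are charged a constant
  each; the bound on \<open>card U\<close> keeps this within \<open>card W ^ s\<close>.
\<close>

lemma sum_power_degrees_le:
  assumes "simple_graph G" "complete_bipartite_free s t G" "2 \<le> s"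
    and U: "finite U" "U \<subseteq> verts G" and W: "finite W" "W \<subseteq> verts G"
    and UW: "card U \<le> card W ^ 2"
  shows "(\<Sum>u\<in>U. real (card {v \<in> W. {v, u} \<in> edges G}) ^ s)
    \<le> real s ^ s * (real t + 1) * real (card W) ^ s"
proof -
  define d where "d u = card {v \<in> W. {v, u} \<in> edges G}" for u
  have "(\<Sum>u\<in>U. real (d u) ^ s) \<le> (\<Sum>u\<in>U. real s ^ s * (real (d u choose s) + 1))"
    using power_le_self_power_mult_choose assms(3) by (intro sum_mono) auto
  also have "\<dots> = real s ^ s * (real (\<Sum>u\<in>U. d u choose s) + real (card U))"
    by (simp add: sum.distrib flip: sum_distrib_left)
  also have "\<dots> \<le> real s ^ s * (real t * real (card W) ^ s + real (card W) ^ s)"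
  proof (intro mult_left_mono add_mono)
    have "(\<Sum>u\<in>U. d u choose s) \<le> t * (card W choose s)"
      unfolding d_def by (rule sum_degree_choose_le) fact+
    also have "\<dots> \<le> t * card W ^ s"
    proof (cases "s \<le> card W")
      case True
      then show ?thesis by (intro mult_left_mono binomial_le_pow) auto
    qed (simp add: binomial_eq_0)
    finally have "real (\<Sum>u\<in>U. d u choose s) \<le> real (t * card W ^ s)" by (rule of_nat_mono)
    then show "real (\<Sum>u\<in>U. d u choose s) \<le> real t * real (card W) ^ s" by simp
  next
    have "card W ^ 2 \<le> card W ^ s"
      using assms(3) by (cases "card W = 0") (auto intro: power_increasing)
    then have "card U \<le> card W ^ s" using UW by linarith
    then show "real (card U) \<le> real (card W) ^ s" by (metis of_nat_le_iff of_nat_power)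
  qed simp
  finally show ?thesis by (simp add: d_def algebra_simps)
qed

section \<open>Minimum degrees at dyadic scales\<close>

lemma min_degree_le_card_neighbours:
  assumes "v \<in> W" "finite W" "W \<subseteq> verts G"
  shows "min_degree (induced_subgraph G W) \<le> card {u \<in> W. {v, u} \<in> edges G}"
proof -
  have W: "verts G \<inter> W = W" using assms(3) by blast
  have "min_degree (induced_subgraph G W) \<le> degree (induced_subgraph G W) v"
    unfolding min_degree_def using assms W by (intro Min_le) (auto simp: induced_subgraph_def)
  also have "\<dots> = card {u \<in> W. {v, u} \<in> edges G}"
    unfolding degree_def using assms(1) W by (auto simp: induced_subgraph_def intro: arg_cong[where f=card])
  finally show ?thesis .
qed

text \<open>
  The left-hand side has \<open>L\<close> terms, yet the bound is uniform in \<open>L\<close>; this is where the logarithm comes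
  from.
\<close>

lemma sum_dyadic_min_degree_le:
  assumes "simple_graph G" "complete_bipartite_free s t G" "2 \<le> s" "verts G = {1..}"
    and N: "N = 2 ^ L"
  shows "(\<Sum>i=1..L. (real N * real (min_degree (induced_subgraph G {1..2^i * N}))) ^ s
      / real (2^i * N) ^ (s - 1))
    \<le> 4 * 3 ^ (s - 1) * (real s ^ s * (real t + 1)) * real N ^ s"
proof -
  define d where "d u = card {v \<in> {1..N}. {v, u} \<in> edges G}" for u
  have lower: "real N * real (min_degree (induced_subgraph G {1..n})) \<le> (\<Sum>u=1..n. real (d u))"
    if "N \<le> n" for n
  proof -
    have "N * min_degree (induced_subgraph G {1..n})
        = (\<Sum>v=1..N. min_degree (induced_subgraph G {1..n}))" by simp
    also have "\<dots> \<le> (\<Sum>v=1..N. card {u \<in> {1..n}. {v, u} \<in> edges G})"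
      using that assms(4) by (intro sum_mono min_degree_le_card_neighbours) auto
    also have "\<dots> = (\<Sum>u=1..n. d u)"
      unfolding d_def by (rule sum_multicount_gen) auto
    finally have "real (N * min_degree (induced_subgraph G {1..n})) \<le> real (\<Sum>u=1..n. d u)"
      by (rule of_nat_mono)
    then show ?thesis by simp
  qed
  have "(\<Sum>i=1..L. (real N * real (min_degree (induced_subgraph G {1..2^i * N}))) ^ s
      / real (2^i * N) ^ (s - 1))
    \<le> (\<Sum>i=1..L. (\<Sum>u=1..2^i * N. real (d u)) ^ s / real (2^i * N) ^ (s - 1))"
    by (intro sum_mono divide_right_mono power_mono lower) auto
  also have "\<dots> \<le> 4 * 3 ^ (s - 1) * (\<Sum>u=1..2^L * N. real (d u) ^ s)"
    using assms(3) N by (intro sum_dyadic_le) auto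
  also have "\<dots> \<le> 4 * 3 ^ (s - 1) * (real s ^ s * (real t + 1) * real N ^ s)"
    using sum_power_degrees_le[OF assms(1-3), of "{1..2^L * N}" "{1..N}"] assms(4) N
    by (intro mult_left_mono) (auto simp: d_def power2_eq_square)
  finally show ?thesis by (simp add: mult.assoc)
qed

section \<open>The limit inferior\<close>

lemma power_bound_from_normalised_bound:
  fixes x K :: real
  assumes "2 \<le> n" "0 < s" "0 \<le> K"
    and "K < x / (real n powr (1 - 1 / real s) / ln (real n) powr (1 / real s))"
  shows "K ^ s * real n ^ (s - 1) \<le> x ^ s * ln (real n)"
proof -
  define w where "w = ln (real n) powr (1 / real s)"
  define r where "r = real n powr (1 - 1 / real s)"
  have n: "real n > 0" "ln (real n) > 0" using assms(1) by auto
  have w: "w > 0" and r: "r > 0" using n by (auto simp: w_def r_def)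
  have "w ^ s = w powr real s" using w by (simp add: powr_realpow)
  also have "\<dots> = ln (real n)"
    unfolding w_def powr_powr using assms(2) n by simp
  finally have ws: "w ^ s = ln (real n)" .
  have "r ^ s = r powr real s" using r by (simp add: powr_realpow)
  also have "\<dots> = real n powr real (s - 1)"
    unfolding r_def powr_powr using assms(2) by (simp add: left_diff_distrib of_nat_diff)
  also have "\<dots> = real n ^ (s - 1)" using n by (simp add: powr_realpow)
  finally have rs: "r ^ s = real n ^ (s - 1)" .
  have "K * r \<le> x * w" using assms(4) r w by (simp add: w_def[symmetric] r_def[symmetric] field_simps)
  then have "(K * r) ^ s \<le> (x * w) ^ s" using assms(3) r by (intro power_mono) auto
  then show ?thesis by (simp add: power_mult_distrib ws rs)
qed

theorem theorem4p1:
  fixes s t :: nat and G :: "nat graph"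
  assumes "2 \<le> s" and "s \<le> t"
    and "simple_graph G" and "verts G = {1..}"
    and "complete_bipartite_free s t G"
  shows "liminf (\<lambda>n. ereal (real (min_degree (induced_subgraph G {1..n})) /
           (real n powr (1 - 1 / real s) / ln (real n) powr (1 / real s)))) < \<infinity>"
proof (rule ccontr)
  define \<delta> where "\<delta> n = real (min_degree (induced_subgraph G {1..n}))" for n
  define B where "B = 4 * 3 ^ (s - 1) * (real s ^ s * (real t + 1))"
  define K where "K = 2 * B + 1"
  have B: "0 \<le> B" by (simp add: B_def)
  assume "\<not> ?thesis"
  then have "ereal K < liminf (\<lambda>n. ereal (\<delta> n /
           (real n powr (1 - 1 / real s) / ln (real n) powr (1 / real s))))"
    by (simp add: \<delta>_def)
  from less_LiminfD[OF this] obtain n0 where n0: "\<And>n. n0 \<le> n \<Longrightarrow>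
      K < \<delta> n / (real n powr (1 - 1 / real s) / ln (real n) powr (1 / real s))"
    by (auto simp: eventually_sequentially)
  define L where "L = n0 + 1"
  have "0 < real L" by (simp add: L_def)
  define N :: nat where "N = 2 ^ L"
  have N: "n0 \<le> N" "2 \<le> N"
    using less_exp[of L] by (auto simp: N_def L_def simp del: less_exp)
  have term_ge: "K ^ s * real N ^ s / (2 * real L)
      \<le> (real N * \<delta> (2^i * N)) ^ s / real (2^i * N) ^ (s - 1)" if "i \<in> {1..L}" for i
  proof -
    define n where "n = 2^i * N"
    have n: "N \<le> n" by (simp add: n_def)
    have "n = 2 ^ (i + L)" by (simp add: n_def N_def power_add)
    then have "ln (real n) = real (i + L) * ln 2" by (simp add: ln_realpow)
    also have "\<dots> \<le> real (L + L) * 1"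
      using that ln_2_less_1 by (intro mult_mono) auto
    finally have ln: "ln (real n) \<le> 2 * real L" by simp
    have "K ^ s * real n ^ (s - 1) \<le> \<delta> n ^ s * ln (real n)"
      using n N n0[of n] assms(1) B
      by (intro power_bound_from_normalised_bound) (auto simp: K_def)
    also have "\<dots> \<le> \<delta> n ^ s * (2 * real L)"
      using ln by (intro mult_left_mono) (auto simp: \<delta>_def)
    finally have "real N ^ s * (K ^ s * real n ^ (s - 1)) \<le> real N ^ s * (\<delta> n ^ s * (2 * real L))"
      by (rule mult_left_mono) simp
    moreover have "real n > 0" using n N by simp
    ultimately have "K ^ s * real N ^ s / (2 * real L) \<le> (real N * \<delta> n) ^ s / real n ^ (s - 1)"
      by (simp add: L_def power_mult_distrib field_simps)
    then show ?thesis by (simp add: n_def)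
  qed
  have "K * real N ^ s \<le> K ^ s * real N ^ s"
    using B assms(1) self_le_power[of K s] by (intro mult_right_mono) (auto simp: K_def)
  also have "\<dots> = 2 * (\<Sum>i=1..L. K ^ s * real N ^ s / (2 * real L))"
    using \<open>0 < real L\<close> by simp
  also have "\<dots> \<le> 2 * (\<Sum>i=1..L. (real N * \<delta> (2^i * N)) ^ s / real (2^i * N) ^ (s - 1))"
    using term_ge by (intro mult_left_mono sum_mono) auto
  also have "\<dots> \<le> 2 * (B * real N ^ s)"
    using sum_dyadic_min_degree_le[OF assms(3,5,1,4) N_def, folded \<delta>_def B_def]
    by (rule mult_left_mono) simp
  finally have "(2 * B + 1) * real N ^ s \<le> 2 * B * real N ^ s" by (simp add: K_def)
  then show False using N by simp
qed

end
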